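(* Let $N\geqslant1$. (1) Suppose that $(\varphi,\psi)\in\mathfrak t^0_3\times\mathfrak t^0_{3,N}$ satisfies the mixed pentagon equation in $\mathfrak t^0_{4,N}$: $$\psi\big(t^{12}\,|\,t(a)^{23}+t(a)^{24}\big)+\psi\Big(t^{13}+\sum_ct(c)^{23}\,\Big|\,t(a)^{34}\Big)=\varphi\big(t(0)^{23},t(0)^{34}\big)+\psi\Big(t^{12}+t^{13}+\sum_ct(c)^{23}\,\Big|\,t(a)^{24}+t(a)^{34}\Big)+\psi\big(t^{12}\,|\,t(a)^{23}\big).$$ Then it also satisfies the distribution relation for $N'=1$ in $\mathfrak t^0_{3,1}=\mathfrak t^0_3$: $$(\pi_{N1}-\delta_{N1})(\psi)=\rho_{N1}(\psi)\,B.$$ (2) Suppose that $(g,h)\in\exp\mathfrak t^0_3\times\exp\mathfrak t^0_{3,N}$ satisfies the mixed pentagon equation in $\exp\mathfrak t^0_{4,N}$: $$h\big(t^{12}\,|\,t(a)^{23}+t(a)^{24}\big)\,h\Big(t^{13}+\sum_ct(c)^{23}\,\Big|\,t(a)^{34}\Big)=g\big(t(0)^{23},t(0)^{34}\big)\,h\Big(t^{12}+t^{13}+\sum_ct(c)^{23}\,\Big|\,t(a)^{24}+t(a)^{34}\Big)\,h\big(t^{12}\,|\,t(a)^{23}\big).$$ Then it also satisfies the distribution relation for $N'=1$ in $\exp\mathfrak t^0_{3,1}=\exp\mathfrak t^0_3$: $$\pi_{N1}(h)=e^{\rho_{N1}(h)B}\,\delta_{N1}(h).$$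
   Context: Let $\mathbf k$ be a field of characteristic $0$. For $n\geqslant2$, $N\geqslant1$, $\mathfrak t_{n,N}$ is the completed (with respect to the grading where generators have degree 1) $\mathbf k$-Lie algebra with generators $t^{1i}$ ($2\leqslant i\leqslant n$) and $t(a)^{ij}$ ($i\ne j$, $2\leqslant i,j\leqslant n$, $a\in\mathbf Z/N\mathbf Z$) and relations, for all $a,b\in\mathbf Z/N\mathbf Z$ and all distinct $i,j,k,l\in\{2,\dots,n\}$: $t(a)^{ij}=t(-a)^{ji}$; $[t(a)^{ij},t(a+b)^{ik}+t(b)^{jk}]=0$; $[t^{1i}+t^{1j}+\sum_c t(c)^{ij},t(a)^{ij}]=0$; $[t^{1i},t^{1j}+\sum_c t(c)^{ij}]=0$; $[t^{1i},t(a)^{jk}]=0$; $[t(a)^{ij},t(b)^{kl}]=0$. All sums over $c$ are over $c\in\mathbf Z/N\mathbf Z$. $\mathfrak t^0_{n,N}\subset\mathfrak t_{n,N}$ is the (completed) Lie subalgebra generated by all these generators except $t^{1n}$. $\mathfrak t^0_{3,N}$ is the completed free Lie algebra on $A:=t^{12}$ and $B(a):=t(a)^{23}$ ($a\in\mathbf Z/N\mathbf Z$). For $N=1$ write $\mathfrak t^0_n=\mathfrak t^0_{n,1}$; $\mathfrak t^0_3$ is the completed free Lie algebra on $A=t^{12}$, $B=B(0)=t^{23}$. $\exp\mathfrak g$ denotes the group of group-like elements (exponentials) in the completed enveloping algebra of $\mathfrak g$. For $x$ in $\mathfrak t^0_3$ or $\exp\mathfrak t^0_3$, $x(X,Y)$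 is the image of $x$ under $A\mapsto X$, $B\mapsto Y$; for $x$ in $\mathfrak t^0_{3,N}$ or $\exp\mathfrak t^0_{3,N}$, $x(X\,|\,Y_a)$ is the image of $x$ under $A\mapsto X$, $B(a)\mapsto Y_a$ ($a\in\mathbf Z/N\mathbf Z$). $\pi_{N1},\delta_{N1}:\mathfrak t^0_{3,N}\to\mathfrak t^0_3$ are the Lie algebra morphisms $\pi_{N1}:A\mapsto NA,\ B(a)\mapsto B$ for all $a$; $\delta_{N1}:A\mapsto A,\ B(0)\mapsto B,\ B(a)\mapsto0$ for $a\neq0$; the same symbols denote the induced maps on group-like elements. $c_W(x)$ denotes the coefficient of the noncommutative monomial $W$ in $x$, and $\rho_{N1}(x)=c_{B}(\pi_{N1}(x))-c_{B(0)}(x)$ for $x\in\mathfrak t^0_{3,N}$ or $x\in\exp\mathfrak t^0_{3,N}$. *)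

theory Defs
  imports Complex_Main "HOL-Library.Set_Algebras"
begin

section \<open>Noncommutative formal power series\<close>

text \<open>A series over the letters \<open>'x\<close> is the family of its coefficients \<open>c\<^sub>W\<close>, indexed by the
  words \<open>W\<close>. Letter types may be infinite; the alphabet in use is always given as a finite set of letters.\<close>

typedef ('x, 'k) ncseries = "UNIV :: ('x list \<Rightarrow> 'k) set"
  morphisms coeff Series by simp

setup_lifting type_definition_ncseries

lemma ncseries_eqI: "(\<And>w. coeff f w = coeff g w) \<Longrightarrow> f = g"
  by (metis coeff_inject ext)

lemma coeff_Series [simp]: "coeff (Series c) = c"
  by (simp add: Series_inverse)

instantiation ncseries :: (type, ring_1) ring_1
begin

lift_definition zero_ncseries :: "('a, 'b) ncseries" is "\<lambda>w. 0" .
lift_definition one_ncseries :: "('a, 'b) ncseries" is "\<lambda>w. if w = [] then 1 else 0" .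
lift_definition plus_ncseries :: "('a, 'b) ncseries \<Rightarrow> ('a, 'b) ncseries \<Rightarrow> ('a, 'b) ncseries"
  is "\<lambda>f g w. f w + g w" .
lift_definition minus_ncseries :: "('a, 'b) ncseries \<Rightarrow> ('a, 'b) ncseries \<Rightarrow> ('a, 'b) ncseries"
  is "\<lambda>f g w. f w - g w" .
lift_definition uminus_ncseries :: "('a, 'b) ncseries \<Rightarrow> ('a, 'b) ncseries"
  is "\<lambda>f w. - f w" .
lift_definition times_ncseries :: "('a, 'b) ncseries \<Rightarrow> ('a, 'b) ncseries \<Rightarrow> ('a, 'b) ncseries"
  is "\<lambda>f g w. \<Sum>i\<le>length w. f (take i w) * g (drop i w)" .

instance
proof
  fix a b c :: "('a, 'b) ncseries"
  show "a * b * c = a * (b * c)"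
  proof (transfer, rule ext)
    fix f g h :: "'a list \<Rightarrow> 'b" and w :: "'a list"
    let ?n = "length w"
    let ?F = "\<lambda>i j. f (take i w) * g (take (j - i) (drop i w)) * h (drop j w)"
    have "(\<Sum>j\<le>?n. (\<Sum>i\<le>length (take j w). f (take i (take j w)) * g (drop i (take j w))) * h (drop j w))
        = (\<Sum>j\<le>?n. \<Sum>i\<le>j. ?F i j)"
      by (auto intro!: sum.cong simp: sum_distrib_right min_def drop_take)
    also have "\<dots> = (\<Sum>i\<le>?n. \<Sum>j\<in>{i..?n}. ?F i j)"
      unfolding sum.Sigma[OF finite_atMost ballI[OF finite_atMost]]
        sum.Sigma[OF finite_atMost ballI[OF finite_atLeastAtMost]]
      by (rule sum.reindex_bij_witness[where i="\<lambda>(i, j). (j, i)" and j="\<lambda>(i, j). (j, i)"]) auto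
    also have "\<dots> = (\<Sum>i\<le>?n. \<Sum>k\<le>?n - i. ?F i (i + k))"
    proof (rule sum.cong[OF refl])
      fix i assume "i \<in> {..?n}"
      then show "(\<Sum>j\<in>{i..?n}. ?F i j) = (\<Sum>k\<le>?n - i. ?F i (i + k))"
        by (intro sum.reindex_bij_witness[where i="\<lambda>k. i + k" and j="\<lambda>j. j - i"]) auto
    qed
    also have "\<dots> = (\<Sum>i\<le>?n. f (take i w) *
        (\<Sum>k\<le>length (drop i w). g (take k (drop i w)) * h (drop k (drop i w))))"
      by (simp add: sum_distrib_left mult.assoc add.commute)
    finally show "(\<Sum>j\<le>?n. (\<Sum>i\<le>length (take j w). f (take i (take j w)) * g (drop i (take j w))) * h (drop j w))
        = (\<Sum>i\<le>?n. f (take i w) *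
        (\<Sum>k\<le>length (drop i w). g (take k (drop i w)) * h (drop k (drop i w))))" .
  qed
  show "1 * a = a"
  proof (transfer, rule ext)
    fix f :: "'a list \<Rightarrow> 'b" and w :: "'a list"
    have "(\<Sum>i\<le>length w. (if take i w = [] then 1 else 0) * f (drop i w))
        = (\<Sum>i\<le>length w. if i = 0 then f w else 0)"
      by (rule sum.cong) auto
    then show "(\<Sum>i\<le>length w. (if take i w = [] then 1 else 0) * f (drop i w)) = f w"
      by simp
  qed
  show "a * 1 = a"
  proof (transfer, rule ext)
    fix f :: "'a list \<Rightarrow> 'b" and w :: "'a list"
    have "(\<Sum>i\<le>length w. f (take i w) * (if drop i w = [] then 1 else 0))
        = (\<Sum>i\<le>length w. if i = length w then f w else 0)"
      by (rule sum.cong) auto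
    then show "(\<Sum>i\<le>length w. f (take i w) * (if drop i w = [] then 1 else 0)) = f w"
      by simp
  qed
  show "(a + b) * c = a * c + b * c"
    by transfer (simp add: distrib_right sum.distrib)
  show "a * (b + c) = a * b + a * c"
    by transfer (simp add: distrib_left sum.distrib)
  show "(0 :: ('a, 'b) ncseries) \<noteq> 1"
    by transfer (metis zero_neq_one)
qed (transfer, simp add: algebra_simps)+

end

lift_definition scale :: "'k::ring_1 \<Rightarrow> ('x, 'k) ncseries \<Rightarrow> ('x, 'k) ncseries" (infixr "\<cdot>" 75)
  is "\<lambda>c f w. c * f w" .

definition letter :: "'x \<Rightarrow> ('x, 'k::ring_1) ncseries" where
  "letter x = Series (\<lambda>w. if w = [x] then 1 else 0)"

definition hom_part :: "nat \<Rightarrow> ('x, 'k::ring_1) ncseries \<Rightarrow> ('x, 'k) ncseries" where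
  "hom_part d f = Series (\<lambda>w. if length w = d then coeff f w else 0)"

definition nc_poly :: "'x set \<Rightarrow> ('x, 'k::ring_1) ncseries set" where
  "nc_poly D = {f. finite {w. coeff f w \<noteq> 0} \<and> (\<forall>w. coeff f w \<noteq> 0 \<longrightarrow> set w \<subseteq> D)}"

text \<open>Only meaningful when \<open>f\<close> has no constant term: then \<open>f ^ k\<close> has no term of degree \<open>< k\<close>,
  so that the truncation of the exponential series at \<open>length w\<close> loses nothing.\<close>

definition nc_exp :: "('x, 'k::field_char_0) ncseries \<Rightarrow> ('x, 'k) ncseries" where
  "nc_exp f = Series (\<lambda>w. \<Sum>k\<le>length w. coeff (f ^ k) w / fact k)"

text \<open>Degree completion of a graded subspace: all series \<open>\<Sum>d. f\<^sub>d\<close> with \<open>f\<^sub>d \<in> V\<close> of degree \<open>d\<close>.\<close>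

definition completion :: "('x, 'k::ring_1) ncseries set \<Rightarrow> ('x, 'k) ncseries set" where
  "completion V = {f. \<forall>d. hom_part d f \<in> V}"


section \<open>Lie algebras given by generators and relations\<close>

definition lie_br :: "('x, 'k::ring_1) ncseries \<Rightarrow> ('x, 'k) ncseries \<Rightarrow> ('x, 'k) ncseries" where
  "lie_br x y = x * y - y * x"

text \<open>The free Lie algebra is realised as the Lie subalgebra of the free associative algebra that
  is generated by the letters.\<close>

inductive_set free_lie :: "'x set \<Rightarrow> ('x, 'k::ring_1) ncseries set" for D :: "'x set" where
  letter: "x \<in> D \<Longrightarrow> letter x \<in> free_lie D"
| zero: "0 \<in> free_lie D"
| add: "f \<in> free_lie D \<Longrightarrow> g \<in> free_lie D \<Longrightarrow> f + g \<in> free_lie D"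
| scale: "f \<in> free_lie D \<Longrightarrow> c \<cdot> f \<in> free_lie D"
| br: "f \<in> free_lie D \<Longrightarrow> g \<in> free_lie D \<Longrightarrow> lie_br f g \<in> free_lie D"

inductive_set lie_ideal :: "'x set \<Rightarrow> ('x, 'k::ring_1) ncseries set \<Rightarrow> ('x, 'k) ncseries set"
  for D :: "'x set" and R :: "('x, 'k) ncseries set" where
  base: "r \<in> R \<Longrightarrow> r \<in> lie_ideal D R"
| zero: "0 \<in> lie_ideal D R"
| add: "f \<in> lie_ideal D R \<Longrightarrow> g \<in> lie_ideal D R \<Longrightarrow> f + g \<in> lie_ideal D R"
| scale: "f \<in> lie_ideal D R \<Longrightarrow> c \<cdot> f \<in> lie_ideal D R"
| br: "f \<in> free_lie D \<Longrightarrow> g \<in> lie_ideal D R \<Longrightarrow> lie_br f g \<in> lie_ideal D R"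

inductive_set two_sided_ideal :: "'x set \<Rightarrow> ('x, 'k::ring_1) ncseries set \<Rightarrow> ('x, 'k) ncseries set"
  for D :: "'x set" and R :: "('x, 'k) ncseries set" where
  base: "r \<in> R \<Longrightarrow> r \<in> two_sided_ideal D R"
| zero: "0 \<in> two_sided_ideal D R"
| add: "f \<in> two_sided_ideal D R \<Longrightarrow> g \<in> two_sided_ideal D R \<Longrightarrow> f + g \<in> two_sided_ideal D R"
| left: "p \<in> nc_poly D \<Longrightarrow> f \<in> two_sided_ideal D R \<Longrightarrow> p * f \<in> two_sided_ideal D R"
| right: "p \<in> nc_poly D \<Longrightarrow> f \<in> two_sided_ideal D R \<Longrightarrow> f * p \<in> two_sided_ideal D R"


section \<open>The Lie algebras \<open>t\<^sub>n\<^sub>,\<^sub>N\<close>\<close>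

text \<open>Classes in \<open>Z/NZ\<close> are represented by the integers in \<open>{0..<N}\<close>. \<open>T1 i\<close> stands for
  \<open>t\<^sup>1\<^sup>i\<close> and \<open>T a i j\<close> for \<open>t(a)\<^sup>i\<^sup>j\<close>.\<close>

datatype gen = T1 nat | T int nat nat

definition gens :: "nat \<Rightarrow> nat \<Rightarrow> gen set" where
  "gens n N = {T1 i |i. i \<in> {2..n}} \<union>
     {T a i j |a i j. a \<in> {0..<int N} \<and> i \<in> {2..n} \<and> j \<in> {2..n} \<and> i \<noteq> j}"

definition t1 :: "nat \<Rightarrow> (gen, 'k::ring_1) ncseries" where
  "t1 i = letter (T1 i)"

text \<open>The argument \<open>a\<close> is an arbitrary integer, read modulo \<open>N\<close>.\<close>

definition t :: "nat \<Rightarrow> int \<Rightarrow> nat \<Rightarrow> nat \<Rightarrow> (gen, 'k::ring_1) ncseries" where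
  "t N a i j = letter (T (a mod int N) i j)"

definition tsum :: "nat \<Rightarrow> nat \<Rightarrow> nat \<Rightarrow> (gen, 'k::ring_1) ncseries" where
  "tsum N i j = (\<Sum>c\<in>{0..<int N}. t N c i j)"

definition relators :: "nat \<Rightarrow> nat \<Rightarrow> (gen, 'k::ring_1) ncseries set" where
  "relators n N =
     {t N a i j - t N (- a) j i |a i j. {i, j} \<subseteq> {2..n} \<and> distinct [i, j]}
   \<union> {lie_br (t N a i j) (t N (a + b) i k + t N b j k) |a b i j k.
        {i, j, k} \<subseteq> {2..n} \<and> distinct [i, j, k]}
   \<union> {lie_br (t1 i + t1 j + tsum N i j) (t N a i j) |a i j. {i, j} \<subseteq> {2..n} \<and> distinct [i, j]}
   \<union> {lie_br (t1 i) (t1 j + tsum N i j) |i j. {i, j} \<subseteq> {2..n} \<and> distinct [i, j]}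
   \<union> {lie_br (t1 i) (t N a j k) |a i j k. {i, j, k} \<subseteq> {2..n} \<and> distinct [i, j, k]}
   \<union> {lie_br (t N a i j) (t N b k l) |a b i j k l.
        {i, j, k, l} \<subseteq> {2..n} \<and> distinct [i, j, k, l]}"

text \<open>\<open>t\<^sub>n\<^sub>,\<^sub>N\<close> is the quotient of the completed free Lie algebra on \<open>gens n N\<close> by the closed Lie ideal
  generated by the relators (which are homogeneous); \<open>t_class n N x\<close> is the class of the Lie
  series \<open>x\<close>. Since \<open>t\<^sup>0\<^sub>n\<^sub>,\<^sub>N\<close> is a subalgebra, its elements are compared in \<open>t\<^sub>n\<^sub>,\<^sub>N\<close>.\<close>

definition t_class :: "nat \<Rightarrow> nat \<Rightarrow> (gen, 'k::ring_1) ncseries \<Rightarrow> (gen, 'k) ncseries set" where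
  "t_class n N x = x +o completion (lie_ideal (gens n N) (relators n N))"

text \<open>The enveloping algebra of a Lie algebra presented by generators and relations is the
  associative algebra with the same presentation; \<open>Ut_class n N x\<close> is the class of the series
  \<open>x\<close> in the completed enveloping algebra of \<open>t\<^sub>n\<^sub>,\<^sub>N\<close>.\<close>

definition Ut_class :: "nat \<Rightarrow> nat \<Rightarrow> (gen, 'k::ring_1) ncseries \<Rightarrow> (gen, 'k) ncseries set" where
  "Ut_class n N x = x +o completion (two_sided_ideal (gens n N) (relators n N))"


section \<open>The completed free Lie algebras \<open>t\<^sup>0\<^sub>3\<^sub>,\<^sub>N\<close>\<close>

datatype ab = LA | LB int

definition ab_letters :: "nat \<Rightarrow> ab set" where
  "ab_letters N = insert LA (LB ` {0..<int N})"

definition A :: "(ab, 'k::ring_1) ncseries" where "A = letter LA"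

definition B :: "int \<Rightarrow> (ab, 'k::ring_1) ncseries" where "B a = letter (LB a)"

definition t03 :: "nat \<Rightarrow> (ab, 'k::ring_1) ncseries set" where
  "t03 N = completion (free_lie (ab_letters N))"

definition exp_t03 :: "nat \<Rightarrow> (ab, 'k::field_char_0) ncseries set" where
  "exp_t03 N = nc_exp ` t03 N"

text \<open>The image of \<open>x\<close> under \<open>A \<mapsto> X\<close>, \<open>B(a) \<mapsto> Y a\<close>, for series \<open>X\<close>, \<open>Y a\<close> without constant term:
  then words \<open>u\<close> longer than \<open>w\<close> do not contribute to the coefficient of \<open>w\<close>.\<close>

definition subst :: "nat \<Rightarrow> (ab, 'k::ring_1) ncseries \<Rightarrow> ('x, 'k) ncseries \<Rightarrow>
    (int \<Rightarrow> ('x, 'k) ncseries) \<Rightarrow> ('x, 'k) ncseries" where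
  "subst N x X Y = Series (\<lambda>w. \<Sum>u | set u \<subseteq> ab_letters N \<and> length u \<le> length w.
     coeff x u * coeff (prod_list (map (case_ab X Y) u)) w)"

definition subst1 :: "(ab, 'k::ring_1) ncseries \<Rightarrow> ('x, 'k) ncseries \<Rightarrow> ('x, 'k) ncseries \<Rightarrow>
    ('x, 'k) ncseries" where
  "subst1 x X Y = subst 1 x X (\<lambda>_. Y)"

definition pi_N1 :: "nat \<Rightarrow> (ab, 'k::ring_1) ncseries \<Rightarrow> (ab, 'k) ncseries" where
  "pi_N1 N x = subst N x (of_nat N \<cdot> A) (\<lambda>a. B 0)"

definition delta_N1 :: "nat \<Rightarrow> (ab, 'k::ring_1) ncseries \<Rightarrow> (ab, 'k) ncseries" where
  "delta_N1 N x = subst N x A (\<lambda>a. if a = 0 then B 0 else 0)"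

definition rho_N1 :: "nat \<Rightarrow> (ab, 'k::ring_1) ncseries \<Rightarrow> 'k" where
  "rho_N1 N x = coeff (pi_N1 N x) [LB 0] - coeff x [LB 0]"

end

theory Submission
  imports Defs
begin

text \<open>
  Forget the first strand of \<open>t\<^sub>4\<^sub>,\<^sub>N\<close>, weight \<open>t(a)\<^sup>i\<^sup>j\<close> by \<open>\<omega> a\<close>, where \<open>\<omega>\<close> is either constantly \<open>1\<close>
  or the indicator of \<open>a = 0\<close>, and divide by the center of the resulting \<open>t\<^sub>3\<close>, so that
  \<open>t\<^sup>2\<^sup>3 = A\<close>, \<open>t\<^sup>3\<^sup>4 = B\<close>, \<open>t\<^sup>2\<^sup>4 = - A - B\<close>. The pentagon becomes an equation between series in \<open>A\<close> and
  \<open>B\<close> in which, besides \<open>\<phi>(A, B)\<close> and the image of \<open>\<psi>\<close> under \<open>\<pi>\<^sub>N\<^sub>1\<close> respectively \<open>\<delta>\<^sub>N\<^sub>1\<close>, every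
  term is a specialization of \<open>\<psi>\<close> to a single variable, hence linear. Thus both images of \<open>\<psi>\<close>
  equal \<open>\<phi>(A, B)\<close> up to multiples of \<open>B\<close> (known) and of \<open>A\<close>. The multiples of \<open>A\<close> agree because
  the pentagon forces the coefficient of \<open>A\<close> in \<open>\<psi>\<close> to vanish. For group-like
  series the same equation holds multiplicatively, with one-variable exponentials of \<open>B\<close> on the
  left and of \<open>A\<close> on the right of \<open>g(A, B)\<close>.
\<close>

section \<open>Coefficients\<close>

lemma coeff_zero [simp]: "coeff 0 w = 0"
  and coeff_one: "coeff 1 w = (if w = [] then 1 else 0)"
  and coeff_add [simp]: "coeff (f + g) w = coeff f w + coeff g w"
  and coeff_diff [simp]: "coeff (f - g) w = coeff f w - coeff g w"
  and coeff_minus [simp]: "coeff (- f) w = - coeff f w"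
  and coeff_mult: "coeff (f * g) w = (\<Sum>i\<le>length w. coeff f (take i w) * coeff g (drop i w))"
  and coeff_scale [simp]: "coeff (c \<cdot> f) w = c * coeff f w"
  and coeff_letter: "coeff (letter x) w = (if w = [x] then 1 else 0)"
  and coeff_hom_part: "coeff (hom_part d f) w = (if length w = d then coeff f w else 0)"
  by (auto simp: zero_ncseries.rep_eq one_ncseries.rep_eq plus_ncseries.rep_eq
      minus_ncseries.rep_eq uminus_ncseries.rep_eq times_ncseries.rep_eq scale.rep_eq
      letter_def hom_part_def)

lemma coeff_sum: "coeff (sum F S) w = (\<Sum>i\<in>S. coeff (F i) w)"
  by (induction S rule: infinite_finite_induct) auto

lemma coeff_mult_Nil [simp]: "coeff (f * g) [] = coeff f [] * coeff g []"
  by (simp add: coeff_mult)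

lemma coeff_mult_single: "coeff (f * g) [x] = coeff f [] * coeff g [x] + coeff f [x] * coeff g []"
  by (simp add: coeff_mult)

lemma scale_zero_left [simp]: "0 \<cdot> f = 0"
  and scale_zero_right [simp]: "c \<cdot> 0 = 0"
  and scale_one [simp]: "1 \<cdot> f = f"
  and scale_scale [simp]: "c \<cdot> d \<cdot> f = (c * d) \<cdot> f"
  and scale_add_left: "(c + d) \<cdot> f = c \<cdot> f + d \<cdot> f"
  and scale_diff_left: "(c - d) \<cdot> f = c \<cdot> f - d \<cdot> f"
  and scale_add_right: "c \<cdot> (f + g) = c \<cdot> f + c \<cdot> g"
  and scale_minus_left: "(- c) \<cdot> f = - (c \<cdot> f)"
  and scale_minus_right: "c \<cdot> (- f) = - (c \<cdot> f)"
  by (rule ncseries_eqI; simp add: algebra_simps)+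

lemma scale_mult_left: "(c \<cdot> f) * g = c \<cdot> (f * g)"
  by (rule ncseries_eqI) (simp add: coeff_mult sum_distrib_left mult.assoc)

lemma scale_mult_right: "f * (c \<cdot> g) = c \<cdot> (f * g)" for c :: "'k::comm_ring_1"
  by (rule ncseries_eqI) (simp add: coeff_mult sum_distrib_left mult.left_commute)

lemma scale_sum_left: "sum c S \<cdot> f = (\<Sum>i\<in>S. c i \<cdot> f)"
  by (rule ncseries_eqI) (simp add: coeff_sum sum_distrib_right)

lemma lie_br_scale: "lie_br (c \<cdot> f) (d \<cdot> g) = (c * d) \<cdot> lie_br f g" for c :: "'k::comm_ring_1"
  by (rule ncseries_eqI)
    (simp add: lie_br_def scale_mult_left scale_mult_right algebra_simps)

lemma lie_br_self [simp]: "lie_br f f = 0"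
  and lie_br_zero_left [simp]: "lie_br 0 f = 0"
  and lie_br_zero_right [simp]: "lie_br f 0 = 0"
  by (simp_all add: lie_br_def)

lemma coeff_power_less:
  assumes "coeff f [] = 0" "length w < k"
  shows "coeff (f ^ k) w = 0"
  using assms(2)
proof (induction k arbitrary: w)
  case (Suc k)
  have "coeff f (take i w) * coeff (f ^ k) (drop i w) = 0" if "i \<le> length w" for i
    using Suc that assms(1) by (cases "i = 0") auto
  then show ?case by (simp add: coeff_mult)
qed simp

lemma coeff_power_nonzero: "coeff f [] = 0 \<Longrightarrow> coeff (f ^ k) w \<noteq> 0 \<Longrightarrow> k \<le> length w"
  using coeff_power_less not_le by blast


section \<open>Substitution homomorphisms\<close>

text \<open>Together the two conditions make substitution finite in every degree: there are finitely
  many words of each length, and the image of a word \<open>u\<close> has no term of degree below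
  \<open>length u\<close>.\<close>

definition admissible :: "'x set \<Rightarrow> ('x \<Rightarrow> ('y, 'k::ring_1) ncseries) \<Rightarrow> bool" where
  "admissible D \<sigma> \<longleftrightarrow> finite D \<and> (\<forall>x\<in>D. coeff (\<sigma> x) [] = 0)"

definition words :: "'x set \<Rightarrow> nat \<Rightarrow> 'x list set" where
  "words D n = {u. set u \<subseteq> D \<and> length u \<le> n}"

text \<open>The cutoff at \<open>length w\<close> is built in, so additivity and the dependence on
  low coefficients hold for every \<open>\<sigma>\<close>; \<open>admissible\<close> enters once the
  cutoff has to be moved, as for products.\<close>

definition ev :: "'x set \<Rightarrow> ('x \<Rightarrow> ('y, 'k::ring_1) ncseries) \<Rightarrow> ('x, 'k) ncseries \<Rightarrow>
    ('y, 'k) ncseries" where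
  "ev D \<sigma> f = Series (\<lambda>w. \<Sum>u\<in>words D (length w).
     coeff f u * coeff (prod_list (map \<sigma> u)) w)"

lemma subst_eq_ev: "subst N f X Y = ev (ab_letters N) (case_ab X Y) f"
  by (simp add: subst_def ev_def words_def)

lemma finite_words: "finite D \<Longrightarrow> finite (words D n)"
  unfolding words_def by (rule finite_lists_length_le)

lemma coeff_monomial_less:
  assumes "admissible D \<sigma>" "set u \<subseteq> D" "length w < length u"
  shows "coeff (prod_list (map \<sigma> u)) w = 0"
  using assms(2,3)
proof (induction u arbitrary: w)
  case (Cons x u)
  have "coeff (\<sigma> x) (take i w) * coeff (prod_list (map \<sigma> u)) (drop i w) = 0"
    if "i \<le> length w" for i
    using Cons that assms(1) by (cases "i = 0") (auto simp: admissible_def)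
  then show ?case by (simp add: coeff_mult)
qed simp

text \<open>The words added by a larger cutoff have images starting in degree above
  \<open>length w\<close>. A cutoff independent of \<open>w\<close> gives all pieces of a split word
  the same index set.\<close>

lemma coeff_ev:
  assumes "admissible D \<sigma>" "length w \<le> n"
  shows "coeff (ev D \<sigma> f) w = (\<Sum>u\<in>words D n. coeff f u * coeff (prod_list (map \<sigma> u)) w)"
  unfolding ev_def coeff_Series
proof (rule sum.mono_neutral_left)
  show "finite (words D n)" using assms(1) by (simp add: finite_words admissible_def)
  show "words D (length w) \<subseteq> words D n" using assms(2) by (auto simp: words_def)
  show "\<forall>u\<in>words D n - words D (length w). coeff f u * coeff (prod_list (map \<sigma> u)) w = 0"
  proof
    fix u assume "u \<in> words D n - words D (length w)"
    then have "coeff (prod_list (map \<sigma> u)) w = 0"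
      by (intro coeff_monomial_less[OF assms(1)]) (auto simp: words_def)
    then show "coeff f u * coeff (prod_list (map \<sigma> u)) w = 0" by simp
  qed
qed

lemma ev_cong: "(\<And>x. x \<in> D \<Longrightarrow> \<sigma> x = \<tau> x) \<Longrightarrow> ev D \<sigma> f = ev D \<tau> f"
  unfolding ev_def
  by (intro arg_cong[where f=Series] ext sum.cong refl arg_cong2[where f="(*)"]
      arg_cong2[where f=coeff] arg_cong[where f=prod_list] map_cong) (auto simp: words_def)

lemma ev_zero [simp]: "ev D \<sigma> 0 = 0"
  and ev_add: "ev D \<sigma> (f + g) = ev D \<sigma> f + ev D \<sigma> g"
  and ev_diff: "ev D \<sigma> (f - g) = ev D \<sigma> f - ev D \<sigma> g"
  and ev_scale: "ev D \<sigma> (c \<cdot> f) = c \<cdot> ev D \<sigma> f"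
  by (rule ncseries_eqI;
      simp add: ev_def distrib_right left_diff_distrib sum.distrib sum_subtractf
        sum_distrib_left mult.assoc)+

lemma ev_sum: "ev D \<sigma> (sum F S) = (\<Sum>i\<in>S. ev D \<sigma> (F i))"
  by (induction S rule: infinite_finite_induct) (auto simp: ev_add)

lemma ev_one [simp]:
  assumes "admissible D \<sigma>" shows "ev D \<sigma> 1 = 1"
proof (rule ncseries_eqI)
  fix w
  have "(\<Sum>u\<in>words D (length w). coeff 1 u * coeff (prod_list (map \<sigma> u)) w)
      = (\<Sum>u\<in>{[]}. coeff 1 u * coeff (prod_list (map \<sigma> u)) w)"
    using assms by (intro sum.mono_neutral_right)
      (auto simp: admissible_def words_def coeff_one intro: finite_words[unfolded words_def])
  then show "coeff (ev D \<sigma> 1) w = coeff 1 w" by (simp add: ev_def coeff_one)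
qed

lemma ev_letter [simp]:
  assumes "admissible D \<sigma>" "x \<in> D" shows "ev D \<sigma> (letter x) = \<sigma> x"
proof (rule ncseries_eqI)
  fix w
  \<comment> \<open>The cutoff is raised by one so that the word \<open>[x]\<close> is in range even
    for empty \<open>w\<close>.\<close>
  have "coeff (ev D \<sigma> (letter x)) w
      = (\<Sum>u\<in>words D (Suc (length w)). coeff (letter x) u * coeff (prod_list (map \<sigma> u)) w)"
    by (rule coeff_ev[OF assms(1)]) simp
  also have "\<dots> = (\<Sum>u\<in>{[x]}. coeff (letter x) u * coeff (prod_list (map \<sigma> u)) w)"
    using assms by (intro sum.mono_neutral_right)
      (auto simp: admissible_def words_def coeff_letter intro: finite_words[unfolded words_def])
  finally show "coeff (ev D \<sigma> (letter x)) w = coeff (\<sigma> x) w" by (simp add: coeff_letter)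
qed

text \<open>Both sides are sums over pairs of words: a pair \<open>(u, v)\<close> on one side is a
  cut of the word \<open>u @ v\<close> on the other. Commutative scalars allow the coefficients to
  be moved past each other.\<close>

lemma ev_mult:
  fixes \<sigma> :: "'x \<Rightarrow> ('y, 'k::comm_ring_1) ncseries"
  assumes adm: "admissible D \<sigma>"
  shows "ev D \<sigma> (f * g) = ev D \<sigma> f * ev D \<sigma> g"
proof (rule ncseries_eqI)
  fix w :: "'y list"
  let ?n = "length w" and ?P = "\<lambda>u. prod_list (map \<sigma> u)"
  let ?F = "\<lambda>(u, v). coeff f u * coeff g v * coeff (?P u * ?P v) w"
  have fin: "finite (words D n)" for n
    using adm by (simp add: finite_words admissible_def)
  have "coeff (ev D \<sigma> f * ev D \<sigma> g) w
      = (\<Sum>i\<le>?n. (\<Sum>u\<in>words D ?n. coeff f u * coeff (?P u) (take i w)) *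
                 (\<Sum>v\<in>words D ?n. coeff g v * coeff (?P v) (drop i w)))"
    unfolding coeff_mult by (rule sum.cong) (auto simp: coeff_ev[OF adm, where n="?n"])
  also have "\<dots> = (\<Sum>i\<le>?n. \<Sum>u\<in>words D ?n. \<Sum>v\<in>words D ?n.
      coeff f u * coeff g v * (coeff (?P u) (take i w) * coeff (?P v) (drop i w)))"
    by (simp add: sum_product algebra_simps)
  also have "\<dots> = (\<Sum>u\<in>words D ?n. \<Sum>v\<in>words D ?n. \<Sum>i\<le>?n.
      coeff f u * coeff g v * (coeff (?P u) (take i w) * coeff (?P v) (drop i w)))"
    by (subst sum.swap) (intro sum.cong refl sum.swap)
  also have "\<dots> = (\<Sum>p\<in>words D ?n \<times> words D ?n. ?F p)"
    by (simp add: sum.cartesian_product[symmetric] coeff_mult sum_distrib_left)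
  \<comment> \<open>Pairs whose concatenation exceeds the cutoff contribute nothing, because the
    image of \<open>u @ v\<close> starts above degree \<open>length w\<close>.\<close>
  also have "\<dots> = (\<Sum>p\<in>{(u, v). u @ v \<in> words D ?n}. ?F p)"
  proof (rule sum.mono_neutral_right)
    show "\<forall>p\<in>words D ?n \<times> words D ?n - {(u, v). u @ v \<in> words D ?n}. ?F p = 0"
    proof
      fix p assume "p \<in> words D ?n \<times> words D ?n - {(u, v). u @ v \<in> words D ?n}"
      then obtain u v where p: "p = (u, v)"
        and uv: "u \<in> words D ?n" "v \<in> words D ?n" "u @ v \<notin> words D ?n" by auto
      then have "coeff (?P (u @ v)) w = 0"
        by (intro coeff_monomial_less[OF adm]) (auto simp: words_def)
      then show "?F p = 0" by (simp add: p)
    qed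
  qed (use fin in \<open>auto simp: words_def\<close>)
  also have "\<dots> = (\<Sum>p\<in>(SIGMA u:words D ?n. {..length u}).
      case p of (u, i) \<Rightarrow> coeff f (take i u) * coeff g (drop i u) * coeff (?P u) w)"
    by (rule sum.reindex_bij_witness[where i="\<lambda>(u, i). (take i u, drop i u)"
          and j="\<lambda>(u, v). (u @ v, length u)"]) auto
  also have "\<dots> = coeff (ev D \<sigma> (f * g)) w"
    by (simp add: ev_def coeff_mult sum.Sigma fin sum_distrib_right)
  finally show "coeff (ev D \<sigma> (f * g)) w = coeff (ev D \<sigma> f * ev D \<sigma> g) w" by simp
qed

lemma ev_lie_br:
  fixes \<sigma> :: "'x \<Rightarrow> ('y, 'k::comm_ring_1) ncseries"
  shows "admissible D \<sigma> \<Longrightarrow> ev D \<sigma> (lie_br f g) = lie_br (ev D \<sigma> f) (ev D \<sigma> g)"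
  by (simp add: lie_br_def ev_diff ev_mult)

lemma ev_power:
  fixes \<sigma> :: "'x \<Rightarrow> ('y, 'k::comm_ring_1) ncseries"
  shows "admissible D \<sigma> \<Longrightarrow> ev D \<sigma> (f ^ n) = ev D \<sigma> f ^ n"
  by (induction n) (auto simp: ev_mult)

lemma ev_prod_list:
  fixes \<sigma> :: "'x \<Rightarrow> ('y, 'k::comm_ring_1) ncseries"
  shows "admissible D \<sigma> \<Longrightarrow> ev D \<sigma> (prod_list fs) = prod_list (map (ev D \<sigma>) fs)"
  by (induction fs) (auto simp: ev_mult)

lemma coeff_ev_Nil [simp]: "coeff (ev D \<sigma> f) [] = coeff f []"
proof -
  have "words D 0 = {[]}" by (auto simp: words_def)
  then show ?thesis by (simp add: ev_def coeff_one)
qed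

lemma coeff_ev_single:
  assumes "finite D"
  shows "coeff (ev D \<sigma> f) [y] = (\<Sum>x\<in>D. coeff f [x] * coeff (\<sigma> x) [y])"
proof -
  have "words D (length [y]) = insert [] ((\<lambda>x. [x]) ` D)"
    by (auto simp: words_def le_Suc_eq length_Suc_conv)
  then show ?thesis
    using assms by (simp add: ev_def coeff_one sum.reindex inj_on_def image_iff)
qed

text \<open>With the common cutoff \<open>length w\<close>, this is an exchange of two finite sums.
  It allows a map out of \<open>t\<^sub>4\<^sub>,\<^sub>N\<close> to be pushed into the arguments of
  a \<open>subst\<close>.\<close>

lemma ev_ev:
  fixes \<sigma> :: "'x \<Rightarrow> ('y, 'k::comm_ring_1) ncseries" and \<tau> :: "'y \<Rightarrow> ('z, 'k) ncseries"
  assumes "admissible D \<sigma>" "admissible E \<tau>"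
  shows "ev E \<tau> (ev D \<sigma> f) = ev D (\<lambda>x. ev E \<tau> (\<sigma> x)) f"
proof (rule ncseries_eqI)
  fix w :: "'z list"
  let ?n = "length w"
  let ?P = "\<lambda>u. prod_list (map \<sigma> u)" and ?Q = "\<lambda>v. prod_list (map \<tau> v)"
  have "coeff (ev E \<tau> (ev D \<sigma> f)) w
      = (\<Sum>v\<in>words E ?n. (\<Sum>u\<in>words D ?n. coeff f u * coeff (?P u) v) * coeff (?Q v) w)"
    unfolding ev_def[of E] coeff_Series
    by (rule sum.cong) (auto simp: words_def coeff_ev[OF assms(1), where n="?n"])
  also have "\<dots> = (\<Sum>u\<in>words D ?n. coeff f u * (\<Sum>v\<in>words E ?n. coeff (?P u) v * coeff (?Q v) w))"
    unfolding sum_distrib_left sum_distrib_right by (subst sum.swap) (simp add: mult.assoc)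
  also have "\<dots> = (\<Sum>u\<in>words D ?n. coeff f u * coeff (ev E \<tau> (?P u)) w)"
    by (simp add: ev_def)
  also have "\<dots> = coeff (ev D (\<lambda>x. ev E \<tau> (\<sigma> x)) f) w"
    by (simp add: ev_prod_list[OF assms(2)] ev_def[of D] o_def)
  finally show "coeff (ev E \<tau> (ev D \<sigma> f)) w = coeff (ev D (\<lambda>x. ev E \<tau> (\<sigma> x)) f) w" .
qed

section \<open>Exponential series and their behaviour under substitution\<close>

lemma coeff_nc_exp:
  assumes "coeff f [] = 0" "length w \<le> n"
  shows "coeff (nc_exp f) w = (\<Sum>k\<le>n. coeff (f ^ k) w / fact k)"
  unfolding nc_exp_def coeff_Series
  by (rule sum.mono_neutral_left) (use assms in \<open>auto dest: coeff_power_nonzero\<close>)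

lemma coeff_nc_exp_Nil [simp]: "coeff (nc_exp f) [] = 1"
  by (simp add: nc_exp_def coeff_one)

lemma coeff_nc_exp_single: "coeff (nc_exp f) [x] = coeff f [x]"
  by (simp add: nc_exp_def coeff_one)

lemma ev_nc_exp:
  fixes \<sigma> :: "'x \<Rightarrow> ('y, 'k::field_char_0) ncseries"
  assumes adm: "admissible D \<sigma>" and f: "coeff f [] = 0"
  shows "ev D \<sigma> (nc_exp f) = nc_exp (ev D \<sigma> f)"
proof (rule ncseries_eqI)
  fix w :: "'y list"
  let ?n = "length w" and ?P = "\<lambda>u. prod_list (map \<sigma> u)"
  have "coeff (ev D \<sigma> (nc_exp f)) w
      = (\<Sum>u\<in>words D ?n. (\<Sum>k\<le>?n. coeff (f ^ k) u / fact k) * coeff (?P u) w)"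
    unfolding ev_def coeff_Series
    by (rule sum.cong) (auto simp: words_def coeff_nc_exp[OF f, where n="?n"])
  also have "\<dots> = (\<Sum>k\<le>?n. (\<Sum>u\<in>words D ?n. coeff (f ^ k) u * coeff (?P u) w) / fact k)"
    unfolding sum_distrib_right sum_divide_distrib by (subst sum.swap) simp
  also have "\<dots> = (\<Sum>k\<le>?n. coeff (ev D \<sigma> (f ^ k)) w / fact k)"
    by (simp add: ev_def)
  also have "\<dots> = coeff (nc_exp (ev D \<sigma> f)) w"
    by (simp add: nc_exp_def ev_power[OF adm])
  finally show "coeff (ev D \<sigma> (nc_exp f)) w = coeff (nc_exp (ev D \<sigma> f)) w" .
qed

lemma nc_exp_zero [simp]: "nc_exp 0 = 1"
proof (rule ncseries_eqI)
  fix w :: "'a list"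
  have "(\<Sum>k\<le>length w. coeff (0 ^ k :: ('a, 'b) ncseries) w / fact k)
      = (\<Sum>k\<le>length w. if k = 0 then coeff 1 w else 0)"
    by (rule sum.cong) (auto simp: power_0_left)
  then show "coeff (nc_exp 0) w = coeff (1 :: ('a, 'b) ncseries) w"
    by (simp add: nc_exp_def)
qed

lemma scale_power: "(c \<cdot> f) ^ n = c ^ n \<cdot> f ^ n" for c :: "'k::comm_ring_1"
  by (induction n) (auto simp: scale_mult_left scale_mult_right mult.commute)

text \<open>Multiples of one series commute, so the usual proof by the binomial theorem applies,
  carried out with all exponential sums truncated at the length of the word under
  consideration.\<close>

lemma nc_exp_scale_add:
  fixes f :: "('x, 'k::field_char_0) ncseries"
  assumes f: "coeff f [] = 0"
  shows "nc_exp (a \<cdot> f) * nc_exp (b \<cdot> f) = nc_exp ((a + b) \<cdot> f)"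
proof (rule ncseries_eqI)
  fix w :: "'x list"
  let ?n = "length w"
  let ?E = "\<lambda>c. \<Sum>k\<le>?n. (c ^ k / fact k) \<cdot> f ^ k"
  have E: "coeff (nc_exp (c \<cdot> f)) v = coeff (?E c) v" if "length v \<le> ?n" for c v
    using that f by (simp add: coeff_nc_exp[where n="?n"] scale_power coeff_sum)
  have "coeff (nc_exp (a \<cdot> f) * nc_exp (b \<cdot> f)) w = coeff (?E a * ?E b) w"
    unfolding coeff_mult by (rule sum.cong) (auto simp: E)
  also have "\<dots> = (\<Sum>i\<le>?n. \<Sum>j\<le>?n. (a ^ i / fact i * (b ^ j / fact j)) * coeff (f ^ (i + j)) w)"
    by (simp add: sum_product scale_mult_left scale_mult_right coeff_sum power_add algebra_simps)
  also have "\<dots> = (\<Sum>(i, j)\<in>{..?n} \<times> {..?n}.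
      (a ^ i / fact i * (b ^ j / fact j)) * coeff (f ^ (i + j)) w)"
    by (simp add: sum.cartesian_product)
  \<comment> \<open>\<open>f ^ (i + j)\<close> has no term of degree below \<open>i + j\<close>, so
    the square of indices may be cut down to a triangle and then summed along its diagonals.\<close>
  also have "\<dots> = (\<Sum>(i, j)\<in>{(i, j). i + j \<le> ?n}.
      (a ^ i / fact i * (b ^ j / fact j)) * coeff (f ^ (i + j)) w)"
    by (rule sum.mono_neutral_right) (auto dest: coeff_power_nonzero[OF f])
  also have "\<dots> = (\<Sum>(k, i)\<in>(SIGMA k:{..?n}. {..k}).
      (a ^ i / fact i * (b ^ (k - i) / fact (k - i))) * coeff (f ^ k) w)"
    by (rule sum.reindex_bij_witness[where i="\<lambda>(k, i). (i, k - i)" and j="\<lambda>(i, j). (i + j, i)"]) auto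
  also have "\<dots> = (\<Sum>k\<le>?n. (\<Sum>i\<le>k. a ^ i / fact i * (b ^ (k - i) / fact (k - i))) * coeff (f ^ k) w)"
    by (simp add: sum.Sigma[symmetric] sum_distrib_right)
  also have "\<dots> = (\<Sum>k\<le>?n. (a + b) ^ k / fact k * coeff (f ^ k) w)"
  proof (rule sum.cong[OF refl])
    fix k
    have "(\<Sum>i\<le>k. a ^ i / fact i * (b ^ (k - i) / fact (k - i))) = (a + b) ^ k / fact k"
      by (simp add: binomial_ring sum_divide_distrib)
        (intro sum.cong refl, simp add: binomial_fact)
    then show "(\<Sum>i\<le>k. a ^ i / fact i * (b ^ (k - i) / fact (k - i))) * coeff (f ^ k) w
        = (a + b) ^ k / fact k * coeff (f ^ k) w" by simp
  qed
  also have "\<dots> = coeff (nc_exp ((a + b) \<cdot> f)) w"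
    by (subst E) (auto simp: coeff_sum)
  finally show "coeff (nc_exp (a \<cdot> f) * nc_exp (b \<cdot> f)) w = coeff (nc_exp ((a + b) \<cdot> f)) w" .
qed


section \<open>Completions\<close>

lemma hom_part_zero [simp]: "hom_part d 0 = 0"
  by (rule ncseries_eqI) (simp add: coeff_hom_part)

lemma zero_in_completion: "0 \<in> V \<Longrightarrow> 0 \<in> completion V"
  by (simp add: completion_def)

text \<open>The sum of the homogeneous parts up to degree \<open>n\<close> serves as
  \<open>p\<close>. Statements about single coefficients thus pass from \<open>V\<close> to its
  completion.\<close>

lemma completion_approx:
  assumes "f \<in> completion V" "0 \<in> V" "\<And>p q. p \<in> V \<Longrightarrow> q \<in> V \<Longrightarrow> p + q \<in> V"
  obtains p where "p \<in> V" "\<And>u. length u \<le> n \<Longrightarrow> coeff p u = coeff f u"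
proof
  have "(\<Sum>d\<in>S. hom_part d f) \<in> V" for S
    by (induction S rule: infinite_finite_induct) (use assms in \<open>auto simp: completion_def\<close>)
  then show "(\<Sum>d\<le>n. hom_part d f) \<in> V" .
qed (simp add: coeff_sum coeff_hom_part)

lemma coeff_ev_approx:
  "(\<And>u. length u \<le> length w \<Longrightarrow> coeff f u = coeff p u) \<Longrightarrow> coeff (ev D \<sigma> f) w = coeff (ev D \<sigma> p) w"
  by (simp add: ev_def words_def)

lemma ev_completion_zero:
  fixes \<sigma> :: "'x \<Rightarrow> ('y, 'k::ring_1) ncseries"
  assumes "f \<in> completion V" "0 \<in> V" "\<And>p q. p \<in> V \<Longrightarrow> q \<in> V \<Longrightarrow> p + q \<in> V"
    and "\<And>p. p \<in> V \<Longrightarrow> ev D \<sigma> p = 0"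
  shows "ev D \<sigma> f = 0"
proof (rule ncseries_eqI)
  fix w :: "'y list"
  obtain p where p: "p \<in> V" "\<And>u. length u \<le> length w \<Longrightarrow> coeff p u = coeff f u"
    using completion_approx[OF assms(1-3), where n="length w"] by blast
  then have "coeff (ev D \<sigma> f) w = coeff (ev D \<sigma> p) w" by (intro coeff_ev_approx) simp
  then show "coeff (ev D \<sigma> f) w = coeff 0 w" using assms(4)[OF p(1)] by simp
qed

lemma ev_lie_ideal:
  fixes \<sigma> :: "'x \<Rightarrow> ('y, 'k::comm_ring_1) ncseries"
  assumes "admissible D \<sigma>" "\<And>r. r \<in> R \<Longrightarrow> ev D \<sigma> r = 0" "f \<in> lie_ideal E R"
  shows "ev D \<sigma> f = 0"
  using assms(3)
  by induction (use assms(1,2) in \<open>auto simp: ev_add ev_scale ev_lie_br\<close>)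

lemma ev_two_sided_ideal:
  fixes \<sigma> :: "'x \<Rightarrow> ('y, 'k::comm_ring_1) ncseries"
  assumes "admissible D \<sigma>" "\<And>r. r \<in> R \<Longrightarrow> ev D \<sigma> r = 0" "f \<in> two_sided_ideal E R"
  shows "ev D \<sigma> f = 0"
  using assms(3)
  by induction (use assms(1,2) in \<open>auto simp: ev_add ev_mult\<close>)

text \<open>As \<open>0 \<in> I\<close>, the element \<open>x\<close> lies in its own coset, hence
  in that of \<open>y\<close>, and differs from \<open>y\<close> by an element that
  \<open>ev\<close> kills.\<close>

lemma eq_coset_ev:
  assumes "x +o I = y +o I" "0 \<in> I" "\<And>i. i \<in> I \<Longrightarrow> ev D \<sigma> i = 0"
  shows "ev D \<sigma> x = ev D \<sigma> y"
proof -
  have "x + 0 \<in> x +o I" using assms(2) by (rule set_plus_intro2)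
  then obtain i where "i \<in> I" "x = y + i"
    unfolding assms(1) by (auto simp: elt_set_plus_def)
  then show ?thesis using assms(3) by (simp add: ev_add)
qed

text \<open>A substitution killing the relators kills the ideal they generate, and then its
  completion, so it may be applied to an equation between classes.\<close>

lemma t_class_eqD:
  fixes \<sigma> :: "gen \<Rightarrow> ('y, 'k::comm_ring_1) ncseries"
  assumes "t_class n N x = t_class n N y" "admissible D \<sigma>"
    and "\<And>r. r \<in> relators n N \<Longrightarrow> ev D \<sigma> r = 0"
  shows "ev D \<sigma> x = ev D \<sigma> y"
  using assms(1) unfolding t_class_def
  by (rule eq_coset_ev)
    (blast intro: zero_in_completion lie_ideal.zero lie_ideal.add
      ev_completion_zero ev_lie_ideal[OF assms(2,3)])+

lemma Ut_class_eqD: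
  fixes \<sigma> :: "gen \<Rightarrow> ('y, 'k::comm_ring_1) ncseries"
  assumes "Ut_class n N x = Ut_class n N y" "admissible D \<sigma>"
    and "\<And>r. r \<in> relators n N \<Longrightarrow> ev D \<sigma> r = 0"
  shows "ev D \<sigma> x = ev D \<sigma> y"
  using assms(1) unfolding Ut_class_def
  by (rule eq_coset_ev)
    (blast intro: zero_in_completion two_sided_ideal.zero two_sided_ideal.add
      ev_completion_zero ev_two_sided_ideal[OF assms(2,3)])+

section \<open>Lie series specialized to one variable\<close>

lemma coeff_Nil_lie: "f \<in> free_lie D \<Longrightarrow> coeff f [] = 0" for f :: "('x, 'k::comm_ring_1) ncseries"
  by (induction rule: free_lie.induct) (auto simp: coeff_letter lie_br_def)

lemma coeff_Nil_completed_lie: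
  fixes f :: "('x, 'k::comm_ring_1) ncseries"
  assumes "f \<in> completion (free_lie D)"
  shows "coeff f [] = 0"
proof -
  have "hom_part 0 f \<in> free_lie D" using assms by (simp add: completion_def)
  from coeff_Nil_lie[OF this] show ?thesis by (simp add: coeff_hom_part)
qed

text \<open>Multiples of a single series commute, so brackets are killed and only the linear part of a
  Lie series survives.\<close>

lemma ev_line_lie:
  fixes Z :: "('y, 'k::comm_ring_1) ncseries"
  assumes "admissible D (\<lambda>x. c x \<cdot> Z)" "f \<in> free_lie D"
  shows "ev D (\<lambda>x. c x \<cdot> Z) f = (\<Sum>x\<in>D. coeff f [x] * c x) \<cdot> Z"
  using assms(2)
proof induction
  case (letter x)
  have "finite D" using assms(1) by (simp add: admissible_def)
  have "(\<Sum>y\<in>D. coeff (letter x) [y] * c y) = (\<Sum>y\<in>D. if y = x then c y else 0)"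
    by (rule sum.cong) (auto simp: coeff_letter)
  also have "\<dots> = c x" using letter \<open>finite D\<close> by simp
  finally show ?case using letter assms(1) by simp
next
  case (br f g)
  \<comment> \<open>Lie elements have no constant term, so a bracket has no linear part. Its image
    is a bracket of two multiples of \<open>Z\<close>, hence zero as well.\<close>
  have "coeff (lie_br f g) [x] = 0" for x
    using br(1,2) by (simp add: lie_br_def coeff_mult_single coeff_Nil_lie)
  then show ?case using br assms(1) by (simp add: ev_lie_br lie_br_scale)
qed (auto simp: ev_add ev_scale scale_add_left sum.distrib distrib_right sum_distrib_left mult.assoc)

lemma ev_line:
  fixes Z :: "('y, 'k::comm_ring_1) ncseries"
  assumes "admissible D \<sigma>" "\<And>x. x \<in> D \<Longrightarrow> \<sigma> x = c x \<cdot> Z" "f \<in> completion (free_lie D)"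
  shows "ev D \<sigma> f = (\<Sum>x\<in>D. coeff f [x] * c x) \<cdot> Z"
proof (rule ncseries_eqI)
  fix w :: "'y list"
  \<comment> \<open>The approximation goes one degree beyond \<open>w\<close>: the linear
    coefficients of \<open>f\<close> on the right-hand side must be those of \<open>p\<close> even
    when \<open>w\<close> is empty.\<close>
  obtain p where p: "p \<in> free_lie D" "\<And>u. length u \<le> Suc (length w) \<Longrightarrow> coeff p u = coeff f u"
    using completion_approx[OF assms(3), where n="Suc (length w)"]
    by (metis free_lie.zero free_lie.add)
  have adm: "admissible D (\<lambda>x. c x \<cdot> Z)"
    using assms(1,2) by (auto simp: admissible_def)
  have "coeff (ev D \<sigma> f) w = coeff (ev D (\<lambda>x. c x \<cdot> Z) p) w"
    using p(2) ev_cong[of D \<sigma> "\<lambda>x. c x \<cdot> Z"] assms(2)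
    by (metis coeff_ev_approx le_SucI)
  then show "coeff (ev D \<sigma> f) w = coeff ((\<Sum>x\<in>D. coeff f [x] * c x) \<cdot> Z) w"
    using p by (simp add: ev_line_lie[OF adm])
qed


section \<open>Collapsing \<open>t\<^sub>4\<^sub>,\<^sub>N\<close> onto two letters\<close>

lemma ev_subst:
  fixes \<sigma> :: "'x \<Rightarrow> ('y, 'k::comm_ring_1) ncseries"
  assumes "admissible D \<sigma>" "coeff X [] = 0" "\<And>a. coeff (Y a) [] = 0"
  shows "ev D \<sigma> (subst N f X Y) = subst N f (ev D \<sigma> X) (\<lambda>a. ev D \<sigma> (Y a))"
proof -
  have "admissible (ab_letters N) (case_ab X Y)"
    using assms(2,3) by (auto simp: admissible_def ab_letters_def)
  then have "ev D \<sigma> (subst N f X Y) = ev (ab_letters N) (\<lambda>x. ev D \<sigma> (case_ab X Y x)) f"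
    using assms(1) by (simp add: subst_eq_ev ev_ev)
  also have "\<dots> = subst N f (ev D \<sigma> X) (\<lambda>a. ev D \<sigma> (Y a))"
    unfolding subst_eq_ev by (rule ev_cong) (simp split: ab.split)
  finally show ?thesis .
qed

lemma subst_cong:
  "X = X' \<Longrightarrow> (\<And>a. a \<in> {0..<int N} \<Longrightarrow> Y a = Y' a) \<Longrightarrow> subst N f X Y = subst N f X' Y'"
  unfolding subst_eq_ev by (rule ev_cong) (auto simp: ab_letters_def)

lemma finite_ab_letters [simp]: "finite (ab_letters N)"
  by (simp add: ab_letters_def)

lemma sum_ab_letters: "(\<Sum>x\<in>ab_letters N. F x) = F LA + (\<Sum>a\<in>{0..<int N}. F (LB a))"
proof -
  have "LA \<notin> LB ` {0..<int N}" "inj_on LB {0..<int N}" by (auto simp: inj_on_def)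
  then show ?thesis unfolding ab_letters_def by (simp add: sum.reindex)
qed

lemma coeff_subst_single:
  "coeff (subst N f X Y) [y] = coeff f [LA] * coeff X [y]
     + (\<Sum>a\<in>{0..<int N}. coeff f [LB a] * coeff (Y a) [y])"
  unfolding subst_eq_ev
  by (simp add: coeff_ev_single sum_ab_letters)

lemma subst_line:
  fixes \<psi> :: "(ab, 'k::comm_ring_1) ncseries"
  assumes "\<psi> \<in> t03 N" "coeff Z [] = 0"
  shows "subst N \<psi> (p \<cdot> Z) (\<lambda>a. q a \<cdot> Z)
    = (coeff \<psi> [LA] * p + (\<Sum>a\<in>{0..<int N}. coeff \<psi> [LB a] * q a)) \<cdot> Z"
proof -
  have "subst N \<psi> (p \<cdot> Z) (\<lambda>a. q a \<cdot> Z)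
      = (\<Sum>x\<in>ab_letters N. coeff \<psi> [x] * case_ab p q x) \<cdot> Z"
    unfolding subst_eq_ev
    by (rule ev_line) (use assms in \<open>auto simp: admissible_def ab_letters_def t03_def\<close>)
  also have "(\<Sum>x\<in>ab_letters N. coeff \<psi> [x] * case_ab p q x)
      = coeff \<psi> [LA] * p + (\<Sum>a\<in>{0..<int N}. coeff \<psi> [LB a] * q a)"
    by (simp add: sum_ab_letters)
  finally show ?thesis .
qed

text \<open>Reduces one-variable specializations of group-like series to \<open>subst_line\<close>,
  so that they become exponentials of a multiple of that variable.\<close>

lemma subst_nc_exp:
  fixes \<psi> :: "(ab, 'k::field_char_0) ncseries"
  assumes "\<psi> \<in> t03 N" "coeff X [] = 0" "\<And>a. coeff (Y a) [] = 0"
  shows "subst N (nc_exp \<psi>) X Y = nc_exp (subst N \<psi> X Y)"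
proof -
  have "admissible (ab_letters N) (case_ab X Y)"
    using assms(2,3) by (auto simp: admissible_def ab_letters_def)
  moreover have "coeff \<psi> [] = 0"
    using assms(1) unfolding t03_def by (rule coeff_Nil_completed_lie)
  ultimately show ?thesis unfolding subst_eq_ev by (rule ev_nc_exp)
qed

section \<open>Images of the generators, and the relators of
  \<open>t\<^sub>4\<^sub>,\<^sub>N\<close>\<close>

lemma coeff_gens_Nil [simp]:
  "coeff (t1 i) [] = 0" "coeff (t N a i j) [] = 0" "coeff (tsum N i j) [] = 0"
  "coeff A [] = 0" "coeff (B b) [] = 0"
  by (auto simp: t1_def t_def tsum_def A_def B_def coeff_letter coeff_sum)

lemma finite_gens [simp]: "finite (gens n N)"
proof -
  have "gens n N \<subseteq> T1 ` {2..n} \<union> (\<lambda>(a, i, j). T a i j) ` ({0..<int N} \<times> {2..n} \<times> {2..n})"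
    by (auto simp: gens_def image_iff)
  then show ?thesis by (rule finite_subset) simp
qed

context
  fixes n N :: nat and \<sigma> :: "gen \<Rightarrow> ('y, 'k::comm_ring_1) ncseries"
  assumes N: "N \<ge> 1" and adm: "admissible (gens n N) \<sigma>"
begin

lemma ev_t1: "i \<in> {2..n} \<Longrightarrow> ev (gens n N) \<sigma> (t1 i) = \<sigma> (T1 i)"
  unfolding t1_def by (rule ev_letter[OF adm]) (simp add: gens_def)

lemma ev_t:
  "i \<in> {2..n} \<Longrightarrow> j \<in> {2..n} \<Longrightarrow> i \<noteq> j \<Longrightarrow> ev (gens n N) \<sigma> (t N a i j) = \<sigma> (T (a mod int N) i j)"
  unfolding t_def using N by (intro ev_letter[OF adm]) (simp add: gens_def)

lemma ev_tsum:
  "i \<in> {2..n} \<Longrightarrow> j \<in> {2..n} \<Longrightarrow> i \<noteq> j \<Longrightarrow>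
    ev (gens n N) \<sigma> (tsum N i j) = (\<Sum>c\<in>{0..<int N}. \<sigma> (T c i j))"
  unfolding tsum_def by (simp add: ev_sum ev_t)

end

text \<open>The test on unordered pairs builds in the symmetry. For distinct indices among 2, 3, 4
  the last branch is the pair \<open>{2, 4}\<close>.\<close>

definition tau :: "nat \<Rightarrow> nat \<Rightarrow> (ab, 'k::comm_ring_1) ncseries" where
  "tau i j = (if {i, j} = {2, 3} then A else if {i, j} = {3, 4} then B 0 else - A - B 0)"

lemma tau_simps [simp]: "tau 2 3 = A" "tau 3 4 = B 0" "tau 2 4 = - A - B 0"
  by (auto simp: tau_def doubleton_eq_iff)

lemma tau_commute: "tau i j = tau j i"
  by (simp add: tau_def insert_commute)

lemma tau_swap [simp]: "tau 3 2 = A" "tau 4 3 = B 0" "tau 4 2 = - A - B 0"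
  by (subst tau_commute, simp)+

text \<open>The sum of the three \<open>tau\<close> is the central element of
  \<open>t\<^sub>3\<close>, which has been set to zero.\<close>

lemma tau_sum:
  assumes "{i, j, k} \<subseteq> {2..4}" "distinct [i, j, k]"
  shows "tau i k + tau j k = - tau i j"
proof -
  have "i \<in> {2, 3, 4}" "j \<in> {2, 3, 4}" "k \<in> {2, 3, 4}" using assms(1) by auto
  with assms(2) show ?thesis by auto
qed

lemma relators_4_cases:
  assumes "r \<in> relators 4 N"
  obtains
    (sym) a i j where "r = t N a i j - t N (- a) j i" "{i, j} \<subseteq> {2..4}" "distinct [i, j]"
  | (tri) a b i j k where "r = lie_br (t N a i j) (t N (a + b) i k + t N b j k)"
      "{i, j, k} \<subseteq> {2..4}" "distinct [i, j, k]"
  | (sum) a i j where "r = lie_br (t1 i + t1 j + tsum N i j) (t N a i j)"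
      "{i, j} \<subseteq> {2..4}" "distinct [i, j]"
  | (one_two) i j where "r = lie_br (t1 i) (t1 j + tsum N i j)"
      "{i, j} \<subseteq> {2..4}" "distinct [i, j]"
  | (one_three) a i j k where "r = lie_br (t1 i) (t N a j k)"
      "{i, j, k} \<subseteq> {2..4}" "distinct [i, j, k]"
proof -
  from assms show thesis
    unfolding relators_def Un_iff mem_Collect_eq
  proof (elim disjE exE conjE, goal_cases)
    case 1
    then show ?thesis by (rule sym)
  next
    case 2
    then show ?thesis by (rule tri)
  next
    case 3
    then show ?thesis by (rule sum)
  next
    case 4
    then show ?thesis by (rule one_two)
  next
    case 5
    then show ?thesis by (rule one_three)
  next
    case (6 a b i j k l)
    \<comment> \<open>The last family of relators is empty here: it would need four distinct indices
      among 2, 3, 4.\<close>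
    then have "card (set [i, j, k, l]) \<le> card {2..4 :: nat}" by (intro card_mono) simp_all
    with 6(3) show ?thesis by (simp only: distinct_card) simp
  qed
qed

text \<open>The axioms say that \<open>\<omega>\<close> is the indicator function of a subgroup of \<open>Z/NZ\<close>: the whole group
  gives \<open>\<pi>\<^sub>N\<^sub>1\<close> and the trivial group gives \<open>\<delta>\<^sub>N\<^sub>1\<close>.\<close>

locale weight =
  fixes N :: nat and \<omega> :: "int \<Rightarrow> 'k::field_char_0"
  assumes N: "N \<ge> 1"
    and weight_mod: "\<omega> (a mod int N) = \<omega> a"
    and weight_minus: "\<omega> (- a) = \<omega> a"
    and weight_add: "\<omega> a \<noteq> 0 \<Longrightarrow> \<omega> (a + b) = \<omega> b"
    and weight_zero: "\<omega> 0 = 1"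
begin

text \<open>The order of the subgroup, as a scalar: \<open>N\<close> for the whole group and 1 for
  the trivial one. It arises as the factor of \<open>A\<close> in the image of
  \<open>tsum N 2 3\<close>.\<close>

definition total :: 'k where
  "total = (\<Sum>a\<in>{0..<int N}. \<omega> a)"

definition twist :: "(ab, 'k) ncseries \<Rightarrow> (ab, 'k) ncseries" where
  "twist f = subst N f (total \<cdot> A) (\<lambda>a. \<omega> a \<cdot> B 0)"

text \<open>This is the coefficient of \<open>B 0\<close> in \<open>twist f\<close>;
  \<open>rho_N1\<close> will be the difference of its values for the two weights.\<close>

definition linear_B :: "(ab, 'k) ncseries \<Rightarrow> 'k" where
  "linear_B f = (\<Sum>a\<in>{0..<int N}. coeff f [LB a] * \<omega> a)"

definition collapse :: "gen \<Rightarrow> (ab, 'k) ncseries" where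
  "collapse = case_gen (\<lambda>_. 0) (\<lambda>a i j. \<omega> a \<cdot> tau i j)"

lemma collapse_simps [simp]:
  "collapse (T1 i) = 0" "collapse (T a i j) = \<omega> a \<cdot> tau i j"
  by (simp_all add: collapse_def)

lemma admissible_collapse: "admissible (gens 4 N) collapse"
  by (auto simp: admissible_def collapse_def tau_def split: gen.split)

lemma ev_collapse:
  "i \<in> {2..4} \<Longrightarrow> ev (gens 4 N) collapse (t1 i) = 0"
  "i \<in> {2..4} \<Longrightarrow> j \<in> {2..4} \<Longrightarrow> i \<noteq> j \<Longrightarrow> ev (gens 4 N) collapse (t N a i j) = \<omega> a \<cdot> tau i j"
  "i \<in> {2..4} \<Longrightarrow> j \<in> {2..4} \<Longrightarrow> i \<noteq> j \<Longrightarrow> ev (gens 4 N) collapse (tsum N i j) = total \<cdot> tau i j"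
  by (simp_all add: ev_t1[OF N admissible_collapse] ev_t[OF N admissible_collapse]
      ev_tsum[OF N admissible_collapse] total_def scale_sum_left weight_mod del: atLeastAtMost_iff)

text \<open>Outside the case \<open>tri\<close>, either \<open>T1\<close> goes to zero, or both
  entries are multiples of the same \<open>tau i j\<close>, or the symmetry of \<open>tau\<close>
  and the evenness of \<open>\<omega>\<close> suffice.\<close>

lemma collapse_relator:
  assumes "r \<in> relators 4 N"
  shows "ev (gens 4 N) collapse r = 0"
  using assms
proof (cases rule: relators_4_cases)
  case (sym a i j)
  then show ?thesis by (simp add: ev_collapse ev_diff tau_commute weight_minus del: atLeastAtMost_iff)
next
  case (tri a b i j k)
  \<comment> \<open>If \<open>\<omega> a\<close> is zero, so is the first entry. Otherwise
    \<open>a\<close> lies in the subgroup, the two weights in the second entry agree, and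
    \<open>tau_sum\<close> makes it a multiple of \<open>tau i j\<close>.\<close>
  have "lie_br (\<omega> a \<cdot> tau i j) (\<omega> (a + b) \<cdot> tau i k + \<omega> b \<cdot> tau j k) = 0"
  proof (cases "\<omega> a = 0")
    case False
    then have "\<omega> (a + b) \<cdot> tau i k + \<omega> b \<cdot> tau j k = (- \<omega> b) \<cdot> tau i j"
      using tau_sum[OF tri(2,3), where 'a='k]
      by (simp add: weight_add scale_minus_left scale_minus_right scale_add_right[symmetric])
    then show ?thesis by (simp only: lie_br_scale lie_br_self scale_zero_right)
  qed simp
  then show ?thesis using tri by (simp add: ev_collapse ev_diff ev_add ev_lie_br[OF admissible_collapse] del: atLeastAtMost_iff)
qed (simp_all add: ev_collapse ev_add ev_lie_br[OF admissible_collapse] lie_br_scale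
    del: atLeastAtMost_iff)

text \<open>Single variables appear because \<open>tau 2 3 + tau 2 4\<close> is \<open>- B 0\<close>
  and \<open>tau 2 4 + tau 3 4\<close> is \<open>- A\<close>. The zeros are written
  \<open>0 \<cdot> B 0\<close> and \<open>0 \<cdot> A\<close> to fit the form of
  \<open>subst_line\<close>.\<close>

lemma collapse_terms:
  "ev (gens 4 N) collapse (subst N f (t1 2) (\<lambda>a. t N a 2 3 + t N a 2 4))
    = subst N f (0 \<cdot> B 0) (\<lambda>a. (- \<omega> a) \<cdot> B 0)"
  "ev (gens 4 N) collapse (subst N f (t1 3 + tsum N 2 3) (\<lambda>a. t N a 3 4)) = twist f"
  "ev (gens 4 N) collapse (subst1 g (t N 0 2 3) (t N 0 3 4)) = subst1 g A (B 0)"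
  "ev (gens 4 N) collapse (subst N f (t1 2 + t1 3 + tsum N 2 3) (\<lambda>a. t N a 2 4 + t N a 3 4))
    = subst N f (total \<cdot> A) (\<lambda>a. (- \<omega> a) \<cdot> A)"
  "ev (gens 4 N) collapse (subst N f (t1 2) (\<lambda>a. t N a 2 3)) = subst N f (0 \<cdot> A) (\<lambda>a. \<omega> a \<cdot> A)"
  by (simp_all add: ev_subst[OF admissible_collapse] subst1_def twist_def ev_add ev_collapse weight_zero
      scale_add_right[symmetric] scale_minus_left scale_minus_right[symmetric])

lemma lie_collapse:
  assumes \<psi>: "\<psi> \<in> t03 N"
    and eq: "t_class 4 N
          (subst N \<psi> (t1 2) (\<lambda>a. t N a 2 3 + t N a 2 4)
           + subst N \<psi> (t1 3 + tsum N 2 3) (\<lambda>a. t N a 3 4))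
        = t_class 4 N
          (subst1 \<phi> (t N 0 2 3) (t N 0 3 4)
           + subst N \<psi> (t1 2 + t1 3 + tsum N 2 3) (\<lambda>a. t N a 2 4 + t N a 3 4)
           + subst N \<psi> (t1 2) (\<lambda>a. t N a 2 3))"
  obtains c where "twist \<psi> = linear_B \<psi> \<cdot> B 0 + subst1 \<phi> A (B 0) + c \<cdot> A"
proof -
  \<comment> \<open>The values of these scalars are left open; only the multiple of
    \<open>B 0\<close> has to be known explicitly.\<close>
  obtain c d where cd:
    "subst N \<psi> (total \<cdot> A) (\<lambda>a. (- \<omega> a) \<cdot> A) = c \<cdot> A"
    "subst N \<psi> (0 \<cdot> A) (\<lambda>a. \<omega> a \<cdot> A) = d \<cdot> A"
    by (rule that) (rule subst_line[OF \<psi> coeff_gens_Nil(4)])+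
  have "subst N \<psi> (0 \<cdot> B 0) (\<lambda>a. (- \<omega> a) \<cdot> B 0) = (- linear_B \<psi>) \<cdot> B 0"
    by (subst subst_line[OF \<psi>]) (simp_all add: linear_B_def sum_negf)
  with t_class_eqD[OF eq admissible_collapse collapse_relator] cd
  have "(- linear_B \<psi>) \<cdot> B 0 + twist \<psi> = subst1 \<phi> A (B 0) + c \<cdot> A + d \<cdot> A"
    by (simp only: ev_add collapse_terms)
  then have "twist \<psi> = linear_B \<psi> \<cdot> B 0 + subst1 \<phi> A (B 0) + (c + d) \<cdot> A"
    by (simp add: scale_minus_left scale_add_left algebra_simps)
  then show ?thesis by (rule that)
qed

lemma group_collapse:
  assumes \<psi>: "\<psi> \<in> t03 N" and h: "h = nc_exp \<psi>"
    and eq: "Ut_class 4 N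
          (subst N h (t1 2) (\<lambda>a. t N a 2 3 + t N a 2 4)
           * subst N h (t1 3 + tsum N 2 3) (\<lambda>a. t N a 3 4))
        = Ut_class 4 N
          (subst1 g (t N 0 2 3) (t N 0 3 4)
           * subst N h (t1 2 + t1 3 + tsum N 2 3) (\<lambda>a. t N a 2 4 + t N a 3 4)
           * subst N h (t1 2) (\<lambda>a. t N a 2 3))"
  obtains c where "twist h = nc_exp (linear_B h \<cdot> B 0) * subst1 g A (B 0) * nc_exp (c \<cdot> A)"
proof -
  obtain c d where cd:
    "subst N h (total \<cdot> A) (\<lambda>a. (- \<omega> a) \<cdot> A) = nc_exp (c \<cdot> A)"
    "subst N h (0 \<cdot> A) (\<lambda>a. \<omega> a \<cdot> A) = nc_exp (d \<cdot> A)"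
    by (simp add: h subst_nc_exp[OF \<psi>] subst_line[OF \<psi>] del: scale_zero_left)
  \<comment> \<open>The exponential does not change linear coefficients.\<close>
  have "linear_B h = linear_B \<psi>" by (simp add: linear_B_def h coeff_nc_exp_single)
  then have "subst N h (0 \<cdot> B 0) (\<lambda>a. (- \<omega> a) \<cdot> B 0) = nc_exp ((- linear_B h) \<cdot> B 0)"
    by (simp add: h subst_nc_exp[OF \<psi>] subst_line[OF \<psi>] linear_B_def sum_negf
        del: scale_zero_left)
  with Ut_class_eqD[OF eq admissible_collapse collapse_relator] cd
  have "nc_exp ((- linear_B h) \<cdot> B 0) * twist h
      = subst1 g A (B 0) * nc_exp (c \<cdot> A) * nc_exp (d \<cdot> A)"
    by (simp only: ev_mult[OF admissible_collapse] collapse_terms)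
  \<comment> \<open>Multiplying on the left by the inverse exponential isolates
    \<open>twist h\<close>.\<close>
  then have "nc_exp (linear_B h \<cdot> B 0) * nc_exp ((- linear_B h) \<cdot> B 0) * twist h
      = nc_exp (linear_B h \<cdot> B 0) * subst1 g A (B 0) * (nc_exp (c \<cdot> A) * nc_exp (d \<cdot> A))"
    by (simp add: mult.assoc)
  then have "twist h = nc_exp (linear_B h \<cdot> B 0) * subst1 g A (B 0) * nc_exp ((c + d) \<cdot> A)"
    by (simp add: nc_exp_scale_add)
  then show ?thesis by (rule that)
qed

end

section \<open>Vanishing of the coefficient of \<open>A\<close>, by a second specialization of the
  pentagon\<close>

definition pick_T12 :: "gen \<Rightarrow> (ab, 'k::comm_ring_1) ncseries" where
  "pick_T12 x = (if x = T1 2 then A else 0)"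

lemma admissible_pick: "admissible (gens 4 N) pick_T12"
  by (auto simp: admissible_def pick_T12_def)

lemma pick_T12_simps:
  assumes "N \<ge> 1"
  shows "i \<in> {2..4} \<Longrightarrow> ev (gens 4 N) pick_T12 (t1 i) = (if i = 2 then A else 0)"
    "i \<in> {2..4} \<Longrightarrow> j \<in> {2..4} \<Longrightarrow> i \<noteq> j \<Longrightarrow> ev (gens 4 N) pick_T12 (t N a i j) = 0"
    "i \<in> {2..4} \<Longrightarrow> j \<in> {2..4} \<Longrightarrow> i \<noteq> j \<Longrightarrow> ev (gens 4 N) pick_T12 (tsum N i j) = 0"
  by (simp_all add: ev_t1[OF assms admissible_pick] ev_t[OF assms admissible_pick]
      ev_tsum[OF assms admissible_pick] pick_T12_def del: atLeastAtMost_iff)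

text \<open>Only \<open>t\<^sup>1\<^sup>2\<close> survives, and in every bracket among the relators
  at least one entry does not involve it.\<close>

lemma pick_relator:
  assumes N: "N \<ge> 1" and "r \<in> relators 4 N"
  shows "ev (gens 4 N) pick_T12 r = 0"
  using assms(2)
  by (cases rule: relators_4_cases)
    (simp_all add: pick_T12_simps[OF N] ev_diff ev_add ev_lie_br[OF admissible_pick]
      del: atLeastAtMost_iff)

lemma pick_terms:
  assumes "N \<ge> 1"
  shows "ev (gens 4 N) pick_T12 (subst N f (t1 2) (\<lambda>a. t N a 2 3 + t N a 2 4)) = subst N f A (\<lambda>_. 0)"
  "ev (gens 4 N) pick_T12 (subst N f (t1 3 + tsum N 2 3) (\<lambda>a. t N a 3 4)) = subst N f 0 (\<lambda>_. 0)"
  "ev (gens 4 N) pick_T12 (subst1 g (t N 0 2 3) (t N 0 3 4)) = subst 1 g 0 (\<lambda>_. 0)"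
  "ev (gens 4 N) pick_T12 (subst N f (t1 2 + t1 3 + tsum N 2 3) (\<lambda>a. t N a 2 4 + t N a 3 4))
    = subst N f A (\<lambda>_. 0)"
  "ev (gens 4 N) pick_T12 (subst N f (t1 2) (\<lambda>a. t N a 2 3)) = subst N f A (\<lambda>_. 0)"
  by (simp_all add: ev_subst[OF admissible_pick] subst1_def ev_add pick_T12_simps[OF assms])

text \<open>After the specialization, \<psi>(A|0) occurs once on the left and twice on the right,
  and the other terms have no coefficient at \<open>A\<close>. So that coefficient of
  \<open>\<psi>\<close> equals its own double.\<close>

lemma coeff_LA_eq_0_lie:
  fixes \<psi> :: "(ab, 'k::field_char_0) ncseries"
  assumes N: "N \<ge> 1"
    and eq: "t_class 4 N
          (subst N \<psi> (t1 2) (\<lambda>a. t N a 2 3 + t N a 2 4)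
           + subst N \<psi> (t1 3 + tsum N 2 3) (\<lambda>a. t N a 3 4))
        = t_class 4 N
          (subst1 \<phi> (t N 0 2 3) (t N 0 3 4)
           + subst N \<psi> (t1 2 + t1 3 + tsum N 2 3) (\<lambda>a. t N a 2 4 + t N a 3 4)
           + subst N \<psi> (t1 2) (\<lambda>a. t N a 2 3))"
  shows "coeff \<psi> [LA] = 0"
proof -
  have "subst N \<psi> A (\<lambda>_. 0) + subst N \<psi> 0 (\<lambda>_. 0)
      = subst 1 \<phi> 0 (\<lambda>_. 0) + subst N \<psi> A (\<lambda>_. 0) + (subst N \<psi> A (\<lambda>_. 0) :: (ab, 'k) ncseries)"
    using t_class_eqD[OF eq admissible_pick pick_relator[OF N]]
    by (simp only: ev_add pick_terms[OF N])
  from arg_cong[OF this, of "\<lambda>f. coeff f [LA]"] show ?thesis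
    by (simp add: coeff_subst_single A_def coeff_letter)
qed

lemma coeff_LA_eq_0_group:
  fixes h :: "(ab, 'k::field_char_0) ncseries"
  assumes N: "N \<ge> 1" and "coeff g [] = 1" "coeff h [] = 1"
    and eq: "Ut_class 4 N
          (subst N h (t1 2) (\<lambda>a. t N a 2 3 + t N a 2 4)
           * subst N h (t1 3 + tsum N 2 3) (\<lambda>a. t N a 3 4))
        = Ut_class 4 N
          (subst1 g (t N 0 2 3) (t N 0 3 4)
           * subst N h (t1 2 + t1 3 + tsum N 2 3) (\<lambda>a. t N a 2 4 + t N a 3 4)
           * subst N h (t1 2) (\<lambda>a. t N a 2 3))"
  shows "coeff h [LA] = 0"
proof -
  have eq': "subst N h A (\<lambda>_. 0) * subst N h 0 (\<lambda>_. 0)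
      = subst 1 g 0 (\<lambda>_. 0) * subst N h A (\<lambda>_. 0) * (subst N h A (\<lambda>_. 0) :: (ab, 'k) ncseries)"
    using Ut_class_eqD[OF eq admissible_pick pick_relator[OF N]]
    by (simp only: ev_mult[OF admissible_pick] pick_terms[OF N])
  have Nil: "coeff (subst M f X Y) [] = coeff f []"
    for M and f X :: "(ab, 'k) ncseries" and Y
    by (simp add: subst_eq_ev)
  \<comment> \<open>All constant terms are 1, so linear coefficients add up over the factors and the
    count is the same as for Lie series.\<close>
  from arg_cong[OF eq', of "\<lambda>f. coeff f [LA]"] show ?thesis
    by (simp add: assms(2,3) Nil coeff_mult_single coeff_subst_single A_def coeff_letter)
qed

section \<open>The two weights and the comparison of the resulting equations\<close>

lemma weight_one: "N \<ge> 1 \<Longrightarrow> weight N (\<lambda>_. 1)"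
  by unfold_locales auto

text \<open>Divisibility by \<open>N\<close> expresses that the class of \<open>a\<close> is zero
  for every integer \<open>a\<close>, as periodicity of the weight demands; on the representatives
  it reduces to \<open>a = 0\<close>.\<close>

lemma weight_delta: "N \<ge> 1 \<Longrightarrow> weight N (\<lambda>a. of_bool (int N dvd a))"
  by unfold_locales (auto simp: dvd_mod_iff dvd_add_right_iff)

lemma dvd_residue_iff: "a \<in> {0..<int N} \<Longrightarrow> int N dvd a \<longleftrightarrow> a = 0"
  by (auto dest: zdvd_imp_le)

theorem proposition2p9:
  fixes N :: nat
  assumes "N \<ge> 1"
  shows
    "(\<forall>\<phi> \<psi> :: (ab, 'k::field_char_0) ncseries.
        \<phi> \<in> t03 1 \<longrightarrow> \<psi> \<in> t03 N \<longrightarrow>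
        t_class 4 N
          (subst N \<psi> (t1 2) (\<lambda>a. t N a 2 3 + t N a 2 4)
           + subst N \<psi> (t1 3 + tsum N 2 3) (\<lambda>a. t N a 3 4))
        = t_class 4 N
          (subst1 \<phi> (t N 0 2 3) (t N 0 3 4)
           + subst N \<psi> (t1 2 + t1 3 + tsum N 2 3) (\<lambda>a. t N a 2 4 + t N a 3 4)
           + subst N \<psi> (t1 2) (\<lambda>a. t N a 2 3)) \<longrightarrow>
        pi_N1 N \<psi> - delta_N1 N \<psi> = rho_N1 N \<psi> \<cdot> B 0)
   \<and> (\<forall>g h :: (ab, 'k) ncseries.
        g \<in> exp_t03 1 \<longrightarrow> h \<in> exp_t03 N \<longrightarrow>
        Ut_class 4 N
          (subst N h (t1 2) (\<lambda>a. t N a 2 3 + t N a 2 4)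
           * subst N h (t1 3 + tsum N 2 3) (\<lambda>a. t N a 3 4))
        = Ut_class 4 N
          (subst1 g (t N 0 2 3) (t N 0 3 4)
           * subst N h (t1 2 + t1 3 + tsum N 2 3) (\<lambda>a. t N a 2 4 + t N a 3 4)
           * subst N h (t1 2) (\<lambda>a. t N a 2 3)) \<longrightarrow>
        pi_N1 N h = nc_exp (rho_N1 N h \<cdot> B 0) * delta_N1 N h)"
proof -
  interpret one: weight N "\<lambda>_. 1 :: 'k" by (rule weight_one[OF assms])
  interpret del: weight N "\<lambda>a. of_bool (int N dvd a) :: 'k" by (rule weight_delta[OF assms])
  have del_sum: "(\<Sum>a\<in>{0..<int N}. q a * of_bool (int N dvd a)) = q 0" for q :: "int \<Rightarrow> 'k"
  proof -
    have "(\<Sum>a\<in>{0..<int N}. q a * of_bool (int N dvd a)) = (\<Sum>a\<in>{0..<int N}. if a = 0 then q a else 0)"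
      by (rule sum.cong[OF refl]) (auto simp: dvd_residue_iff)
    also have "\<dots> = q 0" using assms by simp
    finally show ?thesis .
  qed
  have pi: "one.twist f = pi_N1 N f" for f
    by (simp add: one.twist_def one.total_def pi_N1_def)
  have delta: "del.twist f = delta_N1 N f" for f
    unfolding del.twist_def delta_N1_def
    by (rule subst_cong) (use del_sum[of "\<lambda>_. 1"] in \<open>auto simp: del.total_def dvd_residue_iff\<close>)
  have pi_LA: "coeff (pi_N1 N f) [LA] = of_nat N * coeff f [LA]" for f :: "(ab, 'k) ncseries"
    by (simp add: pi_N1_def coeff_subst_single A_def B_def coeff_letter)
  have delta_LA: "coeff (delta_N1 N f) [LA] = coeff f [LA]" for f :: "(ab, 'k) ncseries"
  proof -
    have "coeff (if a = 0 then B 0 else 0) [LA] = (0 :: 'k)" for a :: int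
      by (simp add: B_def coeff_letter)
    then show ?thesis by (simp add: delta_N1_def coeff_subst_single A_def coeff_letter)
  qed
  have pi_LB: "coeff (pi_N1 N f) [LB 0] = one.linear_B f" for f
    by (simp add: pi_N1_def coeff_subst_single A_def B_def coeff_letter one.linear_B_def)
  have del_LB: "coeff f [LB 0] = del.linear_B f" for f
    by (simp add: del.linear_B_def del_sum)
  \<comment> \<open>\<open>pi_LB\<close> must be applied first, since the left-hand side of
    \<open>del_LB\<close> also matches the coefficient of \<open>pi_N1 N f\<close>.\<close>
  have rho: "rho_N1 N f = one.linear_B f - del.linear_B f" for f
    by (simp only: rho_N1_def pi_LB) (simp only: del_LB)
  show ?thesis
  proof (intro conjI allI impI)
    fix \<phi> \<psi> :: "(ab, 'k) ncseries"
    assume \<psi>: "\<psi> \<in> t03 N" and eq: "t_class 4 N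
          (subst N \<psi> (t1 2) (\<lambda>a. t N a 2 3 + t N a 2 4)
           + subst N \<psi> (t1 3 + tsum N 2 3) (\<lambda>a. t N a 3 4))
        = t_class 4 N
          (subst1 \<phi> (t N 0 2 3) (t N 0 3 4)
           + subst N \<psi> (t1 2 + t1 3 + tsum N 2 3) (\<lambda>a. t N a 2 4 + t N a 3 4)
           + subst N \<psi> (t1 2) (\<lambda>a. t N a 2 3))"
    obtain c d where
      "pi_N1 N \<psi> = one.linear_B \<psi> \<cdot> B 0 + subst1 \<phi> A (B 0) + c \<cdot> A"
      "delta_N1 N \<psi> = del.linear_B \<psi> \<cdot> B 0 + subst1 \<phi> A (B 0) + d \<cdot> A"
      using one.lie_collapse[OF \<psi> eq] del.lie_collapse[OF \<psi> eq] unfolding pi delta by metis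
    then have diff: "pi_N1 N \<psi> - delta_N1 N \<psi> = rho_N1 N \<psi> \<cdot> B 0 + (c - d) \<cdot> A"
      by (simp add: rho scale_diff_left)
    \<comment> \<open>On the left the coefficient of \<open>A\<close> is a multiple of that of
      \<open>\<psi>\<close>, which vanishes; on the right it is \<open>c - d\<close>.\<close>
    from arg_cong[OF this, of "\<lambda>f. coeff f [LA]"] have "c - d = 0"
      by (simp add: pi_LA delta_LA coeff_LA_eq_0_lie[OF assms eq] A_def B_def coeff_letter)
    with diff show "pi_N1 N \<psi> - delta_N1 N \<psi> = rho_N1 N \<psi> \<cdot> B 0" by simp
  next
    fix g h :: "(ab, 'k) ncseries"
    assume g: "g \<in> exp_t03 1" and h: "h \<in> exp_t03 N" and eq: "Ut_class 4 N
          (subst N h (t1 2) (\<lambda>a. t N a 2 3 + t N a 2 4)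
           * subst N h (t1 3 + tsum N 2 3) (\<lambda>a. t N a 3 4))
        = Ut_class 4 N
          (subst1 g (t N 0 2 3) (t N 0 3 4)
           * subst N h (t1 2 + t1 3 + tsum N 2 3) (\<lambda>a. t N a 2 4 + t N a 3 4)
           * subst N h (t1 2) (\<lambda>a. t N a 2 3))"
    obtain \<psi> where \<psi>: "\<psi> \<in> t03 N" "h = nc_exp \<psi>" using h by (auto simp: exp_t03_def)
    have Nil: "coeff g [] = 1" "coeff h [] = 1" using g h by (auto simp: exp_t03_def)
    note LA = coeff_LA_eq_0_group[OF assms Nil eq]
    let ?E = "\<lambda>c Z. nc_exp (c \<cdot> Z) :: (ab, 'k) ncseries" and ?G = "subst1 g A (B 0)"
    obtain c d where
      pi_h: "pi_N1 N h = ?E (one.linear_B h) (B 0) * ?G * ?E c A" and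
      delta_h: "delta_N1 N h = ?E (del.linear_B h) (B 0) * ?G * ?E d A"
      using one.group_collapse[OF \<psi> eq] del.group_collapse[OF \<psi> eq] unfolding pi delta by metis
    \<comment> \<open>Both left-hand sides have zero coefficient at \<open>A\<close>, while the
      products have \<open>coeff g [LA]\<close> plus \<open>c\<close> and plus \<open>d\<close>
      respectively.\<close>
    have "coeff ?G [LA] = coeff g [LA]"
      by (simp add: subst1_def coeff_subst_single A_def B_def coeff_letter)
    moreover have "coeff ?G [] = 1" using Nil by (simp add: subst1_def subst_eq_ev)
    ultimately have "c = d"
      using arg_cong[OF pi_h, of "\<lambda>f. coeff f [LA]"] arg_cong[OF delta_h, of "\<lambda>f. coeff f [LA]"]
      by (simp add: pi_LA delta_LA LA coeff_mult_single coeff_nc_exp_single A_def B_def coeff_letter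
          add_eq_0_iff)
    \<comment> \<open>The exponentials of \<open>B 0\<close> stand next to each other on the left
      and merge: \<open>rho_N1 N h\<close> is exactly the difference of the two values of
      \<open>linear_B\<close>.\<close>
    have "?E (rho_N1 N h) (B 0) * delta_N1 N h
        = (?E (rho_N1 N h) (B 0) * ?E (del.linear_B h) (B 0)) * ?G * ?E d A"
      by (simp add: delta_h mult.assoc)
    also have "\<dots> = pi_N1 N h" by (simp add: nc_exp_scale_add rho pi_h \<open>c = d\<close>)
    finally show "pi_N1 N h = nc_exp (rho_N1 N h \<cdot> B 0) * delta_N1 N h" by simp
  qed
qed

end
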